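(* Let $B\in\{1,\dots,9\}$, let $\tilde p\neq0$ be an integer and $\tilde q$ a positive integer with $\tilde q\geqslant 3600\sqrt[3]{|\tilde p|}$. Let $F_3=B\tilde q^{4}-\tilde p\tilde q+\frac{16}{B}$. Then there is no integer $t$ with $F_3+\frac{32\tilde p}{B^{2}\tilde q^{3}}<t<F_3$ (case $\tilde p<0$), respectively with $F_3<t<F_3+\frac{32\tilde p}{B^{2}\tilde q^{3}}$ (case $\tilde p>0$). *)

theory Defs
  imports Complex_Main
begin

definition F3 :: "int \<Rightarrow> int \<Rightarrow> int \<Rightarrow> real" where
  "F3 B p q = real_of_int B * real_of_int q ^ 4 - real_of_int p * real_of_int q
                + 16 / real_of_int B"

end

theory Submission
  imports Defs
begin

text \<open>The only denominator in \<open>F3\<close> is \<open>B\<close>, so \<open>B * F3\<close>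
  is an integer \<open>N\<close>. The growth hypothesis on \<open>q\<close>, once cubed, says that
  q^3 is at least 3600^3 |p|, so the scaled offset \<open>B * d\<close> has absolute value below 1.
  An integer t in the forbidden interval would put the integer \<open>B * t\<close> strictly between
  \<open>N\<close> and one of its neighbours.\<close>

text \<open>Multiplied by B, the number F3 becomes an integer, whereas the interval next to it becomes
  one of length 32|p|/(B q^3) < 1. Hence B t cannot lie strictly inside.\<close>

theorem theorem7p9:
  fixes B p q :: int
  assumes "B \<in> {1..9}"
    and "p \<noteq> 0"
    and "q > 0"
    and "real_of_int q \<ge> 3600 * root 3 \<bar>real_of_int p\<bar>"
  shows "(p < 0 \<longrightarrow>
           \<not> (\<exists>t::int. F3 B p q + 32 * real_of_int p / (real_of_int B ^ 2 * real_of_int q ^ 3) < real_of_int t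
                      \<and> real_of_int t < F3 B p q))
       \<and> (p > 0 \<longrightarrow>
           \<not> (\<exists>t::int. F3 B p q < real_of_int t
                      \<and> real_of_int t < F3 B p q + 32 * real_of_int p / (real_of_int B ^ 2 * real_of_int q ^ 3)))"
proof -
  define d where "d = 32 * real_of_int p / (real_of_int B ^ 2 * real_of_int q ^ 3)"
  define N where "N = B^2 * q^4 - B * p * q + 16"
  have B: "real_of_int B \<ge> 1" using assms(1) by simp
  have q3: "real_of_int q ^ 3 > 0" using assms(3) by simp
  have "(3600 * root 3 \<bar>real_of_int p\<bar>) ^ 3 \<le> real_of_int q ^ 3"
    by (rule power_mono[OF assms(4)]) simp
  then have "3600 ^ 3 * \<bar>real_of_int p\<bar> \<le> real_of_int q ^ 3"
    by (simp add: power_mult_distrib)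
  \<comment> \<open>Strictness comes from p \<noteq> 0: then |p| > 0, and 32 is far below
    3600^3.\<close>
  then have small: "32 * \<bar>real_of_int p\<bar> < real_of_int q ^ 3"
    using assms(2) by simp
  have BF: "real_of_int B * F3 B p q = real_of_int N"
    using B unfolding F3_def N_def by (simp add: field_simps power2_eq_square)
  have Bd: "real_of_int B * d = 32 * real_of_int p / (real_of_int B * real_of_int q ^ 3)"
    using B unfolding d_def by (simp add: field_simps power2_eq_square)
  \<comment> \<open>Scaling by \<open>B\<close> leaves one factor \<open>B\<close> in the
    denominator of the offset; as B \<ge> 1, it can only shrink the quotient.\<close>
  have "1 * real_of_int q ^ 3 \<le> real_of_int B * real_of_int q ^ 3"
    using B q3 by (intro mult_right_mono) auto
  with small have "32 * \<bar>real_of_int p\<bar> < real_of_int B * real_of_int q ^ 3"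
    by linarith
  with q3 have Bd1: "\<bar>real_of_int B * d\<bar> < 1"
    using B unfolding Bd by (simp add: abs_mult)
  \<comment> \<open>The sign of p enters only through the choice of side; the bound on |B d|
    excludes t on either side.\<close>
  have False if "F3 B p q + d < real_of_int t" "real_of_int t < F3 B p q" for t
  proof -
    have "real_of_int B * (F3 B p q + d) < real_of_int B * real_of_int t"
      "real_of_int B * real_of_int t < real_of_int B * F3 B p q"
      using that B by simp_all
    \<comment> \<open>Both bounds are written as images of integers, so that they can be compared in
      \<open>int\<close>, where N - 1 < B t < N is absurd.\<close>
    then have "real_of_int (N - 1) < real_of_int (B * t)" "real_of_int (B * t) < real_of_int N"
      using Bd1 by (simp_all add: BF distrib_left)
    then show False unfolding of_int_less_iff by simp
  qed
  moreover have False if "F3 B p q < real_of_int t" "real_of_int t < F3 B p q + d" for t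
  proof -
    have "real_of_int B * real_of_int t < real_of_int B * (F3 B p q + d)"
      "real_of_int B * F3 B p q < real_of_int B * real_of_int t"
      using that B by simp_all
    then have "real_of_int (B * t) < real_of_int (N + 1)" "real_of_int N < real_of_int (B * t)"
      using Bd1 by (simp_all add: BF distrib_left)
    then show False unfolding of_int_less_iff by simp
  qed
  ultimately show ?thesis unfolding d_def by blast
qed

end
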